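(* Let $r\ge 1$, let $U^{(1)},\dots,U^{(r)}$ be unitary matrices of sizes $n_1\times n_1,\dots,n_r\times n_r$ with all $n_k\ge 2$, and let $U=U^{(1)}\otimes\cdots\otimes U^{(r)}$. Then the algebraic sum $$\mathbb{M}_U=(\mathbb{M}_U)_{(),()}+\sum_{p=1}^{r-1}\ \sum_{1\le k_1<\dots<k_p\le r}\ \sum_{(v_1,\dots,v_p)\in\{1,\dots,n_{k_1}\}\times\cdots\times\{1,\dots,n_{k_p}\}}(\mathbb{M}_U)_{(k_1,\dots,k_p),(v_1,\dots,v_p)}$$ is a direct sum (of real vector spaces).
   Context: Put $N=n_1\cdots n_r$. A row or column index $i\in\{1,\dots,N\}$ of $U$ is identified with the vector index $[i_1,\dots,i_r]\in\{1,\dots,n_1\}\times\cdots\times\{1,\dots,n_r\}$ by $i=(i_1-1)\prod_{k=2}^r n_k+(i_2-1)\prod_{k=3}^r n_k+\cdots+(i_{r-1}-1)n_r+i_r$ (lexicographic order), so that $U_{i,j}=U^{(1)}_{i_1,j_1}\cdots U^{(r)}_{i_r,j_r}$. For $1\le i<j\le N$ let $M_U^{(i,j)}$ be the complex $N\times N$ matrix whose $i$-th row has entries $U_{i,c}\overline{U_{j,c}}$ ($c=1,\dots,N$), whose $j$-th row has entries $-U_{i,c}\overline{U_{j,c}}$, and whose other rows are zero. Let $A_U^{(i,j)}$ and $S_U^{(i,j)}$ be the entrywise real and imaginary parts of $M_U^{(i,j)}$. Let $\mathbb{M}_U$ be the real linear span, inside the space of real $N\times N$ matrices, of all $A_U^{(i,j)},S_U^{(i,j)}$,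 $1\le i<j\le N$. For $1\le p\le r-1$, $1\le k_1<\dots<k_p\le r$ and $v_s\in\{1,\dots,n_{k_s}\}$, $(\mathbb{M}_U)_{(k_1,\dots,k_p),(v_1,\dots,v_p)}$ denotes the real span of those $A_U^{(i,j)},S_U^{(i,j)}$ ($i<j$) for which $i_{k_s}=j_{k_s}=v_s$ for all $s=1,\dots,p$ and $i_k\ne j_k$ for all $k\in\{1,\dots,r\}\setminus\{k_1,\dots,k_p\}$. $(\mathbb{M}_U)_{(),()}$ denotes the real span of those $A_U^{(i,j)},S_U^{(i,j)}$ ($i<j$) for which $i_k\neq j_k$ for all $k\in\{1,\dots,r\}$. *)

theory Defs
  imports "Jordan_Normal_Form.Schur_Decomposition" "Jordan_Normal_Form.VS_Connect"
begin

text \<open>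
  All indices are shifted to start at 0, as usual for the type of matrices used here: rows and
  columns of an $N \times N$ matrix, the tensor positions $k$ and the entries of a vector index
  run over $\{0,\dots,N-1\}$, $\{0,\dots,r-1\}$ and $\{0,\dots,n_k-1\}$, respectively.
\<close>

subsection \<open>Unitary matrices and Kronecker products\<close>

definition unitary_mat :: "complex mat \<Rightarrow> bool" where
  "unitary_mat A \<longleftrightarrow> square_mat A \<and>
     inverts_mat A (mat_adjoint A) \<and> inverts_mat (mat_adjoint A) A"

definition kron :: "'a :: semiring_1 mat \<Rightarrow> 'a mat \<Rightarrow> 'a mat" where
  "kron A B = mat (dim_row A * dim_row B) (dim_col A * dim_col B)
     (\<lambda>(i, j). A $$ (i div dim_row B, j div dim_col B) * B $$ (i mod dim_row B, j mod dim_col B))"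

definition kron_list :: "'a :: semiring_1 mat list \<Rightarrow> 'a mat" where
  "kron_list As = foldr kron As (1\<^sub>m 1)"

subsection \<open>Vector indices\<close>

text \<open>
  The vector index \<open>v\<close> (with \<open>v k < ns ! k\<close>) is identified with the number \<open>lex_index ns v\<close>;
  \<open>vec_index ns i k\<close> is the entry at position \<open>k\<close> of the vector index identified with \<open>i\<close>.
  The lemmas \<open>lex_index_vec_index\<close> and \<open>vec_index_lex_index\<close> below show that these are mutually
  inverse, and \<open>kron_list_index\<close> that this is the indexing of the Kronecker product.
\<close>

definition lex_index :: "nat list \<Rightarrow> (nat \<Rightarrow> nat) \<Rightarrow> nat" where
  "lex_index ns v = (\<Sum>k<length ns. v k * (\<Prod>l\<in>{Suc k..<length ns}. ns ! l))"

definition vec_index :: "nat list \<Rightarrow> nat \<Rightarrow> nat \<Rightarrow> nat" where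
  "vec_index ns i k = (i div (\<Prod>l\<in>{Suc k..<length ns}. ns ! l)) mod (ns ! k)"

lemma prod_tail_Cons:
  "(\<Prod>l\<in>{Suc (Suc k)..<Suc (length ns)}. (n # ns) ! l) = (\<Prod>l\<in>{Suc k..<length ns}. ns ! l)"
  using prod.shift_bounds_Suc_ivl[of "\<lambda>l. (n # ns) ! l" "Suc k" "length ns"] by simp

lemma prod_tail_Cons_0:
  "(\<Prod>l\<in>{Suc 0..<Suc (length ns)}. (n # ns) ! l) = prod_list ns"
  using prod.shift_bounds_Suc_ivl[of "\<lambda>l. (n # ns) ! l" 0 "length ns"]
  by (simp add: prod.list_conv_set_nth)

lemma lex_index_Nil: "lex_index [] v = 0"
  by (simp add: lex_index_def)

lemma lex_index_Cons:
  "lex_index (n # ns) v = v 0 * prod_list ns + lex_index ns (\<lambda>k. v (Suc k))"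
  unfolding lex_index_def
  by (simp add: sum.lessThan_Suc_shift prod_tail_Cons prod_tail_Cons_0 del: sum.lessThan_Suc prod.op_ivl_Suc nth_Cons_pos)

lemma vec_index_Cons_0: "vec_index (n # ns) i 0 = (i div prod_list ns) mod n"
  by (simp add: vec_index_def prod_tail_Cons_0 del: prod.op_ivl_Suc nth_Cons_pos)

lemma vec_index_Cons_Suc: "vec_index (n # ns) i (Suc k) = vec_index ns i k"
  by (simp add: vec_index_def prod_tail_Cons del: prod.op_ivl_Suc nth_Cons_pos)

lemma vec_index_mod:
  assumes "k < length ns"
  shows "vec_index ns (i mod prod_list ns) k = vec_index ns i k"
proof -
  let ?P = "\<Prod>l\<in>{Suc k..<length ns}. ns ! l"
  have "{0..<length ns} = {0..<k} \<union> {k} \<union> {Suc k..<length ns}"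
    using assms by auto
  then have "prod_list ns = (\<Prod>l\<in>{0..<k} \<union> {k} \<union> {Suc k..<length ns}. ns ! l)"
    by (simp add: prod.list_conv_set_nth)
  also have "\<dots> = (\<Prod>l\<in>{0..<k}. ns ! l) * ns ! k * ?P"
    by (subst prod.union_disjoint; auto simp: algebra_simps)+
  finally obtain c where c: "prod_list ns = ?P * (ns ! k * c)"
    by (metis mult.assoc mult.commute)
  show ?thesis
  proof (cases "?P = 0")
    case True
    show ?thesis unfolding vec_index_def True by simp
  next
    case False
    have "(i mod (?P * (ns ! k * c))) div ?P = i div ?P mod (ns ! k * c)"
      using False by (simp add: mod_mult2_eq)
    then show ?thesis
      unfolding vec_index_def c by (simp add: mod_mult2_eq)
  qed
qed

lemma lex_index_less:
  assumes "\<forall>k<length ns. v k < ns ! k"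
  shows "lex_index ns v < prod_list ns"
  using assms
proof (induction ns arbitrary: v)
  case (Cons n ns)
  then have 1: "v 0 < n" by auto
  have 2: "lex_index ns (\<lambda>k. v (Suc k)) < prod_list ns"
    using Cons.prems by (intro Cons.IH) auto
  have "v 0 * prod_list ns + lex_index ns (\<lambda>k. v (Suc k)) < Suc (v 0) * prod_list ns"
    using 2 by simp
  also have "\<dots> \<le> n * prod_list ns"
    using 1 by (intro mult_le_mono1) simp
  finally show ?case by (simp add: lex_index_Cons)
qed (simp add: lex_index_Nil)

lemma lex_index_vec_index:
  assumes "i < prod_list ns"
  shows "lex_index ns (vec_index ns i) = i"
  using assms
proof (induction ns arbitrary: i)
  case (Cons n ns)
  then have P: "prod_list ns > 0" by (cases "prod_list ns") auto
  have d: "i div prod_list ns < n"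
    using Cons.prems by (simp add: less_mult_imp_div_less)
  have "lex_index ns (vec_index ns i) = lex_index ns (vec_index ns (i mod prod_list ns))"
    unfolding lex_index_def by (intro sum.cong refl) (simp add: vec_index_mod)
  also have "\<dots> = i mod prod_list ns"
    using P by (intro Cons.IH) simp
  finally show ?case
    using d by (simp add: lex_index_Cons vec_index_Cons_0 vec_index_Cons_Suc)
qed (simp add: lex_index_Nil)

lemma vec_index_lex_index:
  assumes "\<forall>k<length ns. v k < ns ! k" and "k < length ns"
  shows "vec_index ns (lex_index ns v) k = v k"
  using assms
proof (induction ns arbitrary: v k)
  case (Cons n ns)
  have l: "lex_index ns (\<lambda>k. v (Suc k)) < prod_list ns"
    using Cons.prems by (intro lex_index_less) auto
  show ?case
  proof (cases k)
    case 0
    have "prod_list ns \<noteq> 0" using l by linarith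
    then have "(v 0 * prod_list ns + lex_index ns (\<lambda>k. v (Suc k))) div prod_list ns = v 0"
      using l by (subst div_mult_self3) auto
    moreover have "v 0 < n" using Cons.prems by auto
    ultimately show ?thesis using 0
      by (simp add: lex_index_Cons vec_index_Cons_0)
  next
    case (Suc m)
    let ?x = "lex_index ns (\<lambda>k. v (Suc k))"
    have "vec_index ns (v 0 * prod_list ns + ?x) m =
        vec_index ns ((v 0 * prod_list ns + ?x) mod prod_list ns) m"
      using Cons.prems Suc by (subst vec_index_mod) auto
    also have "\<dots> = vec_index ns ?x m"
      using l by simp
    also have "\<dots> = v (Suc m)"
      using Cons.prems Suc by (subst Cons.IH) auto
    finally show ?thesis using Suc by (simp add: lex_index_Cons vec_index_Cons_Suc)
  qed
qed simp

lemma kron_list_carrier: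
  assumes "length As = length ns" "\<forall>k<length ns. As ! k \<in> carrier_mat (ns ! k) (ns ! k)"
  shows "kron_list As \<in> carrier_mat (prod_list ns) (prod_list ns)"
  using assms
proof (induction As ns rule: list_induct2)
  case (Cons A As n ns)
  from Cons.prems have "A \<in> carrier_mat n n" by auto
  moreover have "kron_list As \<in> carrier_mat (prod_list ns) (prod_list ns)"
    using Cons.prems by (intro Cons.IH) auto
  ultimately show ?case by (auto simp: kron_list_def kron_def)
qed (simp add: kron_list_def)

lemma kron_list_index:
  fixes As :: "'a :: comm_semiring_1 mat list"
  assumes "length As = length ns" "\<forall>k<length ns. As ! k \<in> carrier_mat (ns ! k) (ns ! k)"
    and "i < prod_list ns" "j < prod_list ns"
  shows "kron_list As $$ (i, j) =
    (\<Prod>k<length ns. (As ! k) $$ (vec_index ns i k, vec_index ns j k))"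
  using assms
proof (induction As ns arbitrary: i j rule: list_induct2)
  case (Cons A As n ns)
  from Cons.prems have A: "A \<in> carrier_mat n n" by auto
  have C: "\<forall>k<length ns. As ! k \<in> carrier_mat (ns ! k) (ns ! k)"
    using Cons.prems by auto
  have B: "kron_list As \<in> carrier_mat (prod_list ns) (prod_list ns)"
    using kron_list_carrier[OF Cons.hyps C] .
  have P: "prod_list ns > 0" using Cons.prems by (cases "prod_list ns") auto
  have d: "i div prod_list ns < n" "j div prod_list ns < n"
    using Cons.prems by (simp_all add: less_mult_imp_div_less)
  have "kron_list (A # As) $$ (i, j) = A $$ (i div prod_list ns, j div prod_list ns) *
      kron_list As $$ (i mod prod_list ns, j mod prod_list ns)"
    using A B Cons.prems by (simp add: kron_list_def kron_def)
  also have "kron_list As $$ (i mod prod_list ns, j mod prod_list ns) =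
      (\<Prod>k<length ns. (As ! k) $$ (vec_index ns i k, vec_index ns j k))"
    using P by (subst Cons.IH[OF C]) (auto intro!: prod.cong simp: vec_index_mod)
  finally show ?case
    using d by (simp add: prod.lessThan_Suc_shift vec_index_Cons_0 vec_index_Cons_Suc
      del: prod.lessThan_Suc)
qed (simp add: kron_list_def)

subsection \<open>The matrices \<open>M_U\<close>, \<open>A_U\<close>, \<open>S_U\<close> and their real spans\<close>

definition M_mat :: "complex mat \<Rightarrow> nat \<Rightarrow> nat \<Rightarrow> complex mat" where
  "M_mat U i j = mat (dim_row U) (dim_row U) (\<lambda>(a, c).
     if a = i then U $$ (i, c) * cnj (U $$ (j, c))
     else if a = j then - (U $$ (i, c) * cnj (U $$ (j, c)))
     else 0)"

definition A_mat :: "complex mat \<Rightarrow> nat \<Rightarrow> nat \<Rightarrow> real mat" where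
  "A_mat U i j = map_mat Re (M_mat U i j)"

definition S_mat :: "complex mat \<Rightarrow> nat \<Rightarrow> nat \<Rightarrow> real mat" where
  "S_mat U i j = map_mat Im (M_mat U i j)"

abbreviation real_mat_space :: "nat \<Rightarrow> (real, real mat) module" where
  "real_mat_space N \<equiv> module_mat TYPE(real) N N"

definition real_span :: "nat \<Rightarrow> real mat set \<Rightarrow> real mat set" where
  "real_span N X = LinearCombinations.module.span class_ring (real_mat_space N) X"

definition MM :: "complex mat \<Rightarrow> real mat set" where
  "MM U = real_span (dim_row U)
     (\<Union>{{A_mat U i j, S_mat U i j} | i j. i < j \<and> j < dim_row U})"

text \<open>Here the lists \<open>ks\<close>, \<open>vs\<close> stand for $(k_1,\dots,k_p)$, $(v_1,\dots,v_p)$, with $p = 0$ allowed.\<close>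

definition MM_sub :: "nat list \<Rightarrow> complex mat \<Rightarrow> nat list \<Rightarrow> nat list \<Rightarrow> real mat set" where
  "MM_sub ns U ks vs = real_span (dim_row U)
     (\<Union>{{A_mat U i j, S_mat U i j} | i j. i < j \<and> j < dim_row U \<and>
        (\<forall>s<length ks. vec_index ns i (ks ! s) = vs ! s \<and> vec_index ns j (ks ! s) = vs ! s) \<and>
        (\<forall>k\<in>{..<length ns} - set ks. vec_index ns i k \<noteq> vec_index ns j k)})"

definition summand_indices :: "nat list \<Rightarrow> (nat list \<times> nat list) set" where
  "summand_indices ns = insert ([], [])
     (\<Union>p\<in>{1..length ns - 1}. {(ks, vs). length ks = p \<and> length vs = p \<and>
        sorted_wrt (<) ks \<and> set ks \<subseteq> {..<length ns} \<and> (\<forall>s<p. vs ! s < ns ! (ks ! s))})"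

subsection \<open>Direct sums\<close>

text \<open>The index set \<open>I\<close> should be finite, as \<open>finsum\<close> is only meaningful then; see
  \<open>finite_summand_indices\<close> below.\<close>

definition algebraic_sum :: "('a, 'c, 'm) module_scheme \<Rightarrow> 'i set \<Rightarrow> ('i \<Rightarrow> 'c set) \<Rightarrow> 'c set" where
  "algebraic_sum V I W = {finsum V w I | w. w \<in> Pi I W}"

definition direct_sum_family :: "('a, 'c, 'm) module_scheme \<Rightarrow> 'i set \<Rightarrow> ('i \<Rightarrow> 'c set) \<Rightarrow> bool" where
  "direct_sum_family V I W \<longleftrightarrow>
     (\<forall>w\<in>Pi I W. \<forall>w'\<in>Pi I W. finsum V w I = finsum V w' I \<longrightarrow> (\<forall>x\<in>I. w x = w' x))"

lemma finite_summand_indices: "finite (summand_indices ns)"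
proof -
  let ?L = "\<lambda>b p. {xs :: nat list. set xs \<subseteq> {..<b} \<and> length xs = p}"
  have "{(ks, vs). length ks = p \<and> length vs = p \<and> sorted_wrt (<) ks \<and>
      set ks \<subseteq> {..<length ns} \<and> (\<forall>s<p. vs ! s < ns ! (ks ! s))}
    \<subseteq> ?L (length ns) p \<times> ?L (sum_list ns) p" for p
  proof -
    have "set vs \<subseteq> {..<sum_list ns}"
      if *: "set ks \<subseteq> {..<length ns}" "length ks = p" "length vs = p"
        "\<forall>s<p. vs ! s < ns ! (ks ! s)" for ks vs
    proof
      fix x assume "x \<in> set vs"
      then obtain i where i: "i < p" "x = vs ! i"
        using * by (auto simp: in_set_conv_nth)
      then have "ks ! i < length ns"
        using * nth_mem by blast
      then have "ns ! (ks ! i) \<le> sum_list ns"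
        by (simp add: member_le_sum_list)
      moreover have "x < ns ! (ks ! i)"
        using * i by simp
      ultimately show "x \<in> {..<sum_list ns}"
        by simp
    qed
    then show ?thesis by auto
  qed
  note sub = this
  show ?thesis
    unfolding summand_indices_def
    by (intro finite.insertI finite_UN_I finite_atLeastAtMost)
      (rule finite_subset[OF sub], intro finite_cartesian_product finite_lists_length_eq, simp_all)
qed

end

theory Submission
  imports Defs
begin

text \<open>
  That the summands add up to the whole of \<open>MM U\<close> is bookkeeping on generators. Two different row
  indices \<open>i\<close>, \<open>j\<close> agree in a well-defined proper subset of the tensor positions, so every
  generator of \<open>MM U\<close> is a generator of one of the summands (\<open>agreement_exists\<close>), and the span of
  a finite union is the algebraic sum of the spans (\<open>real_span_UN\<close>).

  The sum is direct because it is orthogonal. Consider the weighted form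
  $\langle X, Y\rangle = \sum_{a,c} X_{ac} Y_{ac} / |U_{ac}|^2$, where $1/0 = 0$. It is definite on
  \<open>MM U\<close>, since the entries of a matrix there vanish wherever those of \<open>U\<close> do. Row \<open>a\<close> of a
  generator consists of the real parts of $\zeta\, U_{ac} \overline{U_{bc}}$ for a constant
  $\zeta$, where \<open>b\<close> is the other index of the pair. Multiply two such rows, with partners \<open>b\<close> and
  \<open>b'\<close>, and expand the real parts: since \<open>U\<close> is a Kronecker product, each weighted sum over \<open>c\<close>
  becomes a product of sums, one for each tensor position. At a position \<open>k\<close> where \<open>b\<close> agrees
  with \<open>a\<close> and \<open>b'\<close> does not, $U^{(k)}_{b_k m}$ equals $U^{(k)}_{a_k m}$, the weight cancels its
  squared modulus, and what remains is the inner product of two different rows of a unitary matrix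
  or its conjugate, which is 0 (\<open>weighted_products_vanish\<close>). Hence generators with different sets of
  agreement are orthogonal. Generators with the same set of agreement but different common values
  have no nonzero row in common (\<open>M_parts_orthogonal\<close>, \<open>agreement_separates\<close>).
\<close>

section \<open>Spans and algebraic sums of real matrices\<close>

lemma real_span_submodule:
  assumes "X \<subseteq> carrier_mat N N"
  shows "submodule class_ring (real_span N X) (real_mat_space N)"
proof -
  interpret V: matrix_vs N N "TYPE(real)" .
  show ?thesis
    unfolding real_span_def using V.span_is_submodule assms by simp
qed

lemma real_span_closed:
  assumes "X \<subseteq> carrier_mat N N"
  shows "real_span N X \<subseteq> carrier_mat N N"
    and "0\<^sub>m N N \<in> real_span N X"
    and "v \<in> real_span N X \<Longrightarrow> w \<in> real_span N X \<Longrightarrow> v + w \<in> real_span N X"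
    and "v \<in> real_span N X \<Longrightarrow> c \<cdot>\<^sub>m v \<in> real_span N X"
  using real_span_submodule[OF assms]
  by (auto simp: submodule_def matrix_vs_simps)

lemma real_span_superset:
  assumes "X \<subseteq> carrier_mat N N"
  shows "X \<subseteq> real_span N X"
proof -
  interpret V: matrix_vs N N "TYPE(real)" .
  show ?thesis
    unfolding real_span_def using V.in_own_span assms by simp
qed

lemma real_span_mono: "X \<subseteq> Y \<Longrightarrow> real_span N X \<subseteq> real_span N Y"
proof -
  interpret V: matrix_vs N N "TYPE(real)" .
  show "X \<subseteq> Y \<Longrightarrow> real_span N X \<subseteq> real_span N Y"
    unfolding real_span_def by (rule V.span_is_monotone)
qed

lemma real_span_induct [consumes 2, case_names zero gen add smult]:
  assumes "x \<in> real_span N X" and X: "X \<subseteq> carrier_mat N N"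
    and zero: "P (0\<^sub>m N N)"
    and gen: "\<And>g. g \<in> X \<Longrightarrow> P g"
    and add: "\<And>v w. v \<in> carrier_mat N N \<Longrightarrow> w \<in> carrier_mat N N \<Longrightarrow> P v \<Longrightarrow> P w \<Longrightarrow> P (v + w)"
    and smult: "\<And>c v. v \<in> carrier_mat N N \<Longrightarrow> P v \<Longrightarrow> P (c \<cdot>\<^sub>m v)"
  shows "P x"
proof -
  interpret V: matrix_vs N N "TYPE(real)" .
  have "submodule class_ring {v \<in> carrier_mat N N. P v} (real_mat_space N)"
    using zero add smult
    by (auto simp: submodule_def matrix_vs_simps intro: V.module_axioms)
  then have "real_span N X \<subseteq> {v \<in> carrier_mat N N. P v}"
    unfolding real_span_def using X gen by (intro V.span_is_subset) auto
  then show ?thesis using assms(1) by auto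
qed

lemma finsum_mat_carrier:
  assumes "w \<in> I \<rightarrow> carrier_mat N N"
  shows "finsum (real_mat_space N) w I \<in> carrier_mat N N"
proof -
  interpret V: matrix_vs N N "TYPE(real)" .
  show ?thesis using V.finsum_closed assms by simp
qed

lemma finsum_mat_index:
  assumes "finite I" "w \<in> I \<rightarrow> carrier_mat N N" "a < N" "c < N"
  shows "finsum (real_mat_space N) w I $$ (a, c) = (\<Sum>x\<in>I. w x $$ (a, c))"
  using assms(1,2)
proof (induction I rule: finite_induct)
  case empty
  interpret V: matrix_vs N N "TYPE(real)" .
  show ?case using assms by simp
next
  case (insert x I)
  interpret V: matrix_vs N N "TYPE(real)" .
  have w: "w \<in> I \<rightarrow> carrier_mat N N" "w x \<in> carrier_mat N N"
    using insert by auto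
  then have "dim_row (finsum (real_mat_space N) w I) = N" "dim_col (finsum (real_mat_space N) w I) = N"
    using finsum_mat_carrier by blast+
  moreover have "finsum (real_mat_space N) w (insert x I) = w x + finsum (real_mat_space N) w I"
    using insert w by simp
  ultimately show ?case
    using insert.hyps insert.IH[OF w(1)] assms(3,4)
    by simp
qed

lemma finsum_mat_eqI:
  assumes "finite I" "w \<in> I \<rightarrow> carrier_mat N N" "A \<in> carrier_mat N N"
    and "\<And>a c. a < N \<Longrightarrow> c < N \<Longrightarrow> A $$ (a, c) = (\<Sum>x\<in>I. w x $$ (a, c))"
  shows "A = finsum (real_mat_space N) w I"
proof (rule eq_matI)
  note F = finsum_mat_carrier[OF assms(2)]
  show "dim_row A = dim_row (finsum (real_mat_space N) w I)"
    "dim_col A = dim_col (finsum (real_mat_space N) w I)"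
    using F assms(3) by (metis carrier_matD(1), metis carrier_matD(2))
  fix a c
  assume "a < dim_row (finsum (real_mat_space N) w I)" "c < dim_col (finsum (real_mat_space N) w I)"
  then have "a < N" "c < N"
    unfolding carrier_matD[OF F] .
  then show "A $$ (a, c) = finsum (real_mat_space N) w I $$ (a, c)"
    using assms by (simp add: finsum_mat_index)
qed

text \<open>
  By span induction: the algebraic sum contains every generator, as a family with a single nonzero
  member, and adding or scaling the families termwise shows that it is closed.
\<close>

lemma real_span_UN:
  assumes I: "finite I" and G: "\<And>x. x \<in> I \<Longrightarrow> G x \<subseteq> carrier_mat N N"
  shows "real_span N (\<Union>x\<in>I. G x) =
    algebraic_sum (real_mat_space N) I (\<lambda>x. real_span N (G x))"
proof -
  let ?V = "real_mat_space N"
  let ?W = "\<lambda>x. real_span N (G x)"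
  have U: "(\<Union>x\<in>I. G x) \<subseteq> carrier_mat N N"
    using G by auto
  have carr: "w \<in> I \<rightarrow> carrier_mat N N" if "w \<in> Pi I ?W" for w
    using that real_span_closed(1)[OF G] by blast
  show ?thesis
  proof (intro equalityI subsetI)
    fix X assume "X \<in> real_span N (\<Union>x\<in>I. G x)"
    then have "\<exists>w\<in>Pi I ?W. X = finsum ?V w I"
      using U
    proof (induction rule: real_span_induct)
      case zero
      have w: "(\<lambda>_. 0\<^sub>m N N) \<in> Pi I ?W"
        using real_span_closed(2) G by auto
      have "0\<^sub>m N N = finsum ?V (\<lambda>_. 0\<^sub>m N N) I"
        by (rule finsum_mat_eqI[OF I carr[OF w]]) auto
      then show ?case using w by blast
    next
      case (gen g)
      then obtain x where x: "x \<in> I" "g \<in> G x" by auto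
      let ?w = "\<lambda>y. if y = x then g else 0\<^sub>m N N"
      have "g \<in> ?W x"
        using real_span_superset[OF G[OF x(1)]] x(2) by blast
      then have w: "?w \<in> Pi I ?W"
        using real_span_closed(2)[OF G] by auto
      have "g = finsum ?V ?w I"
      proof (rule finsum_mat_eqI[OF I carr[OF w]])
        show "g \<in> carrier_mat N N" using G x by auto
        fix a c assume ac: "a < N" "c < N"
        have "(\<Sum>y\<in>I. ?w y $$ (a, c)) = (\<Sum>y\<in>I. if y = x then g $$ (a, c) else 0)"
          using ac by (intro sum.cong) auto
        then show "g $$ (a, c) = (\<Sum>y\<in>I. ?w y $$ (a, c))"
          using x I by simp
      qed
      then show ?case using w by blast
    next
      case (add v v')
      then obtain w w' where w: "w \<in> Pi I ?W" "v = finsum ?V w I" "w' \<in> Pi I ?W" "v' = finsum ?V w' I"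
        by blast
      have s: "(\<lambda>x. w x + w' x) \<in> Pi I ?W"
        using w by (intro Pi_I real_span_closed(3)[OF G]) blast+
      note c = funcset_mem[OF carr[OF w(1)]] funcset_mem[OF carr[OF w(3)]]
      have "v + v' = finsum ?V (\<lambda>x. w x + w' x) I"
      proof (rule finsum_mat_eqI[OF I carr[OF s]])
        show "v + v' \<in> carrier_mat N N" using add by simp
        fix a b assume ab: "a < N" "b < N"
        have "(v + v') $$ (a, b) = v $$ (a, b) + v' $$ (a, b)"
          using add ab by simp
        also have "\<dots> = (\<Sum>x\<in>I. w x $$ (a, b) + w' x $$ (a, b))"
          unfolding w finsum_mat_index[OF I carr[OF w(1)] ab] finsum_mat_index[OF I carr[OF w(3)] ab]
          by (rule sum.distrib[symmetric])
        also have "\<dots> = (\<Sum>x\<in>I. (w x + w' x) $$ (a, b))"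
        proof (rule sum.cong[OF refl])
          fix x assume "x \<in> I"
          from c[OF this] show "w x $$ (a, b) + w' x $$ (a, b) = (w x + w' x) $$ (a, b)"
            using ab by simp
        qed
        finally show "(v + v') $$ (a, b) = (\<Sum>x\<in>I. (w x + w' x) $$ (a, b))" .
      qed
      then show ?case using s by blast
    next
      case (smult r v)
      then obtain w where w: "w \<in> Pi I ?W" "v = finsum ?V w I"
        by blast
      have s: "(\<lambda>x. r \<cdot>\<^sub>m w x) \<in> Pi I ?W"
        using w by (intro Pi_I real_span_closed(4)[OF G]) blast+
      note c = funcset_mem[OF carr[OF w(1)]]
      have "r \<cdot>\<^sub>m v = finsum ?V (\<lambda>x. r \<cdot>\<^sub>m w x) I"
      proof (rule finsum_mat_eqI[OF I carr[OF s]])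
        show "r \<cdot>\<^sub>m v \<in> carrier_mat N N" using smult by simp
        fix a b assume ab: "a < N" "b < N"
        have "(r \<cdot>\<^sub>m v) $$ (a, b) = r * v $$ (a, b)"
          using smult ab by simp
        also have "\<dots> = (\<Sum>x\<in>I. r * w x $$ (a, b))"
          unfolding w finsum_mat_index[OF I carr[OF w(1)] ab] by (rule sum_distrib_left)
        also have "\<dots> = (\<Sum>x\<in>I. (r \<cdot>\<^sub>m w x) $$ (a, b))"
        proof (rule sum.cong[OF refl])
          fix x assume "x \<in> I"
          from c[OF this] show "r * w x $$ (a, b) = (r \<cdot>\<^sub>m w x) $$ (a, b)"
            using ab by simp
        qed
        finally show "(r \<cdot>\<^sub>m v) $$ (a, b) = (\<Sum>x\<in>I. (r \<cdot>\<^sub>m w x) $$ (a, b))" .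
      qed
      then show ?case using s by blast
    qed
    then show "X \<in> algebraic_sum ?V I ?W"
      unfolding algebraic_sum_def by blast
  next
    fix X assume "X \<in> algebraic_sum ?V I ?W"
    then obtain w where w: "w \<in> Pi I ?W" "X = finsum ?V w I"
      unfolding algebraic_sum_def by blast
    interpret V: matrix_vs N N "TYPE(real)" .
    have "finsum ?V w J \<in> real_span N (\<Union>x\<in>I. G x)" if "J \<subseteq> I" for J
      using finite_subset[OF that I] that
    proof (induction J rule: finite_induct)
      case empty
      show ?case using real_span_closed(2)[OF U] by simp
    next
      case (insert x J)
      then have "w x \<in> real_span N (\<Union>x\<in>I. G x)"
        using w real_span_mono[of "G x" "\<Union>x\<in>I. G x" N] by auto
      moreover have "finsum ?V w (insert x J) = w x + finsum ?V w J"
        using insert carr[OF w(1)] by (subst V.finsum_insert) auto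
      moreover have "finsum ?V w J \<in> real_span N (\<Union>x\<in>I. G x)"
        using insert by simp
      ultimately show ?case
        using real_span_closed(3)[OF U] by metis
    qed
    then show "X \<in> real_span N (\<Union>x\<in>I. G x)"
      using w by simp
  qed
qed

section \<open>Direct sums from orthogonality\<close>

text \<open>
  The weights \<open>q\<close> may vanish, so the form is only semidefinite on all matrices; it is definite on
  the matrices that vanish wherever \<open>q\<close> does.
\<close>

definition weighted_form :: "nat \<Rightarrow> (nat \<Rightarrow> nat \<Rightarrow> real) \<Rightarrow> real mat \<Rightarrow> real mat \<Rightarrow> real" where
  "weighted_form N q X Y = (\<Sum>a<N. \<Sum>c<N. q a c * X $$ (a, c) * Y $$ (a, c))"

lemma weighted_form_commute: "weighted_form N q X Y = weighted_form N q Y X"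
  unfolding weighted_form_def by (intro sum.cong refl) simp

lemma weighted_form_add:
  assumes "v \<in> carrier_mat N N" "w \<in> carrier_mat N N"
  shows "weighted_form N q (v + w) Y = weighted_form N q v Y + weighted_form N q w Y"
  unfolding weighted_form_def sum.distrib[symmetric]
  by (intro sum.cong refl) (use assms in \<open>simp add: algebra_simps\<close>)

lemma weighted_form_smult:
  assumes "v \<in> carrier_mat N N"
  shows "weighted_form N q (r \<cdot>\<^sub>m v) Y = r * weighted_form N q v Y"
  unfolding weighted_form_def sum_distrib_left
  by (intro sum.cong refl) (use assms in simp)

lemma weighted_form_zero: "weighted_form N q (0\<^sub>m N N) Y = 0"
  unfolding weighted_form_def by simp

lemma weighted_form_span:
  assumes "X \<in> real_span N F" "F \<subseteq> carrier_mat N N"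
    and "\<And>g. g \<in> F \<Longrightarrow> weighted_form N q g Y = 0"
  shows "weighted_form N q X Y = 0"
  using assms(1,2)
  by (induction rule: real_span_induct) (simp_all add: assms(3) weighted_form_add weighted_form_smult weighted_form_zero)

lemma weighted_form_spans:
  assumes "X \<in> real_span N F" "F \<subseteq> carrier_mat N N" "Y \<in> real_span N H" "H \<subseteq> carrier_mat N N"
    and "\<And>g h. g \<in> F \<Longrightarrow> h \<in> H \<Longrightarrow> weighted_form N q g h = 0"
  shows "weighted_form N q X Y = 0"
proof (rule weighted_form_span[OF assms(1,2)])
  fix g assume "g \<in> F"
  then show "weighted_form N q g Y = 0"
    using assms(5) weighted_form_span[OF assms(3,4)] by (metis weighted_form_commute)
qed

lemma weighted_form_definite:
  assumes q: "\<And>a c. q a c \<ge> 0" and X: "X \<in> carrier_mat N N"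
    and van: "\<And>a c. a < N \<Longrightarrow> c < N \<Longrightarrow> q a c = 0 \<Longrightarrow> X $$ (a, c) = 0"
    and 0: "weighted_form N q X X = 0"
  shows "X = 0\<^sub>m N N"
proof (rule eq_matI)
  fix a c assume "a < dim_row (0\<^sub>m N N)" "c < dim_col (0\<^sub>m N N)"
  then have ac: "a < N" "c < N" by auto
  have nn: "0 \<le> q a c * X $$ (a, c) * X $$ (a, c)" for a c
    using q[of a c] by (simp add: mult.assoc)
  have "(\<Sum>c<N. q a c * X $$ (a, c) * X $$ (a, c)) = 0"
    using 0 ac nn unfolding weighted_form_def
    by (subst (asm) sum_nonneg_eq_0_iff) (auto intro: sum_nonneg)
  then have "q a c * X $$ (a, c) * X $$ (a, c) = 0"
    using ac nn by (subst (asm) sum_nonneg_eq_0_iff) auto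
  then show "X $$ (a, c) = 0\<^sub>m N N $$ (a, c)"
    using van ac by auto
qed (use X in auto)

text \<open>
  If two families have the same sum, their termwise differences \<open>d x\<close> sum to 0. Pairing this sum
  with \<open>d y\<close> leaves only the term of \<open>d y\<close> with itself, which is therefore 0; this forces
  \<open>d y = 0\<close>, as vanishing where \<open>q\<close> does passes from the generators to their span.
\<close>

lemma direct_sum_family_orthogonal:
  assumes I: "finite I" and G: "\<And>x. x \<in> I \<Longrightarrow> G x \<subseteq> carrier_mat N N"
    and q: "\<And>a c. q a c \<ge> 0"
    and van: "\<And>x g a c. x \<in> I \<Longrightarrow> g \<in> G x \<Longrightarrow> a < N \<Longrightarrow> c < N \<Longrightarrow> q a c = 0 \<Longrightarrow> g $$ (a, c) = 0"
    and orth: "\<And>x y g h. x \<in> I \<Longrightarrow> y \<in> I \<Longrightarrow> x \<noteq> y \<Longrightarrow> g \<in> G x \<Longrightarrow> h \<in> G y \<Longrightarrow>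
      weighted_form N q g h = 0"
  shows "direct_sum_family (real_mat_space N) I (\<lambda>x. real_span N (G x))"
  unfolding direct_sum_family_def
proof (intro ballI impI)
  let ?V = "real_mat_space N" and ?W = "\<lambda>x. real_span N (G x)"
  fix w w' y
  assume w: "w \<in> Pi I ?W" "w' \<in> Pi I ?W" and eq: "finsum ?V w I = finsum ?V w' I" and y: "y \<in> I"
  have c: "w \<in> I \<rightarrow> carrier_mat N N" "w' \<in> I \<rightarrow> carrier_mat N N"
    using w real_span_closed(1)[OF G] by blast+
  define d where "d x = w x + (-1) \<cdot>\<^sub>m w' x" for x
  have dW: "d x \<in> ?W x" if "x \<in> I" for x
    unfolding d_def using w that real_span_closed(3,4)[OF G] by blast
  have dc: "d x \<in> carrier_mat N N" if "x \<in> I" for x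
    using dW real_span_closed(1)[OF G] that by blast
  have d_index: "d x $$ (a, b) = w x $$ (a, b) - w' x $$ (a, b)" if "x \<in> I" "a < N" "b < N" for x a b
    using that funcset_mem[OF c(1) that(1)] funcset_mem[OF c(2) that(1)] unfolding d_def by simp
  have sum0: "(\<Sum>x\<in>I. d x $$ (a, b)) = 0" if "a < N" "b < N" for a b
    using arg_cong[OF eq, of "\<lambda>A. A $$ (a, b)"] that I c
    by (simp add: finsum_mat_index d_index sum_subtractf)
  \<comment> \<open>The form is linear in its second argument, so the sum over \<open>x\<close> can be taken entrywise.\<close>
  have "(\<Sum>x\<in>I. weighted_form N q (d y) (d x)) =
      (\<Sum>a<N. \<Sum>b<N. q a b * d y $$ (a, b) * (\<Sum>x\<in>I. d x $$ (a, b)))"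
    unfolding weighted_form_def sum_distrib_left
    by (subst sum.swap, intro sum.cong refl sum.swap)
  also have "\<dots> = 0"
    by (simp add: sum0)
  finally have "(\<Sum>x\<in>I. weighted_form N q (d y) (d x)) = 0" .
  moreover have "(\<Sum>x\<in>I - {y}. weighted_form N q (d y) (d x)) = 0"
  proof (rule sum.neutral, rule ballI)
    fix x assume x: "x \<in> I - {y}"
    then show "weighted_form N q (d y) (d x) = 0"
      using weighted_form_spans[OF dW[OF y] G[OF y] dW G, of x] orth y by auto
  qed
  ultimately have form0: "weighted_form N q (d y) (d y) = 0"
    using I y by (simp add: sum.remove)
  have "d y $$ (a, b) = 0" if "a < N" "b < N" "q a b = 0" for a b
    using dW[OF y] G[OF y]
    by (induction rule: real_span_induct) (use that van[OF y] in auto)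
  then have d0: "d y = 0\<^sub>m N N"
    by (rule weighted_form_definite[OF q dc[OF y] _ form0])
  then show "w y = w' y"
  proof (intro eq_matI)
    fix a b assume "a < dim_row (w' y)" "b < dim_col (w' y)"
    then show "w y $$ (a, b) = w' y $$ (a, b)"
      using d_index[OF y, of a b] d0 funcset_mem[OF c(2) y] by simp
  qed (use funcset_mem[OF c(1) y] funcset_mem[OF c(2) y] in simp_all)
qed

section \<open>Sums over a Kronecker index\<close>

text \<open>
  As \<open>c\<close> runs through the numbers below the product of the sizes, its vector index runs once
  through all of them, so the left side is the product of the right side, expanded. The induction
  splits off the leading entry by grouping \<open>c\<close> into blocks of length \<open>prod_list ns\<close>.
\<close>

lemma sum_prod_vec_index:
  fixes f :: "nat \<Rightarrow> nat \<Rightarrow> 'a :: comm_semiring_1"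
  shows "(\<Sum>c<prod_list ns. \<Prod>k<length ns. f k (vec_index ns c k)) =
    (\<Prod>k<length ns. \<Sum>m<ns ! k. f k m)"
proof (induction ns arbitrary: f)
  case (Cons n ns)
  let ?P = "prod_list ns"
  let ?g = "\<lambda>c. \<Prod>k<length ns. f (Suc k) (vec_index ns c k)"
  have "(\<Sum>c<n * ?P. f 0 ((c div ?P) mod n) * ?g c) =
      (\<Sum>m<n. \<Sum>c = m * ?P..<m * ?P + ?P. f 0 ((c div ?P) mod n) * ?g c)"
    by (simp add: sum.nat_group)
  also have "\<dots> = (\<Sum>m<n. \<Sum>s<?P. f 0 m * ?g s)"
  proof (rule sum.cong[OF refl])
    fix m assume m: "m \<in> {..<n}"
    have "(\<Sum>c = m * ?P..<m * ?P + ?P. f 0 ((c div ?P) mod n) * ?g c) =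
        (\<Sum>s<?P. f 0 (((s + m * ?P) div ?P) mod n) * ?g (s + m * ?P))"
      using sum.shift_bounds_nat_ivl[of "\<lambda>c. f 0 ((c div ?P) mod n) * ?g c" 0 "m * ?P" ?P]
      by (simp add: add.commute atLeast0LessThan)
    also have "\<dots> = (\<Sum>s<?P. f 0 m * ?g s)"
    proof (rule sum.cong[OF refl])
      fix s assume s: "s \<in> {..<?P}"
      have "vec_index ns (s + m * ?P) k = vec_index ns s k" if "k < length ns" for k
        using vec_index_mod[OF that, of "s + m * ?P"] s by simp
      then show "f 0 (((s + m * ?P) div ?P) mod n) * ?g (s + m * ?P) = f 0 m * ?g s"
        using s m by (cases "?P = 0") (simp_all add: div_mult_self1)
    qed
    finally show "(\<Sum>c = m * ?P..<m * ?P + ?P. f 0 ((c div ?P) mod n) * ?g c) =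
        (\<Sum>s<?P. f 0 m * ?g s)" .
  qed
  also have "\<dots> = (\<Sum>m<n. f 0 m) * (\<Sum>s<?P. ?g s)"
    by (simp add: sum_product)
  also have "(\<Sum>s<?P. ?g s) = (\<Prod>k<length ns. \<Sum>m<ns ! k. f (Suc k) m)"
    by (rule Cons.IH)
  finally show ?case
    by (simp add: prod.lessThan_Suc_shift vec_index_Cons_0 vec_index_Cons_Suc del: prod.lessThan_Suc)
qed simp

lemma unitary_rows_orthogonal:
  assumes A: "A \<in> carrier_mat n n" "unitary_mat A" and ab: "a < n" "b < n" "a \<noteq> b"
  shows "(\<Sum>m<n. A $$ (a, m) * cnj (A $$ (b, m))) = 0"
proof -
  have adj: "mat_adjoint A \<in> carrier_mat n n"
    using A by (auto simp: mat_adjoint_def mat_of_rows_def)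
  have "A * mat_adjoint A = 1\<^sub>m n"
    using A by (auto simp: unitary_mat_def inverts_mat_def)
  then have "(A * mat_adjoint A) $$ (a, b) = 0"
    using ab by simp
  moreover have "(A * mat_adjoint A) $$ (a, b) = (\<Sum>m<n. A $$ (a, m) * mat_adjoint A $$ (m, b))"
    using A(1) adj ab by (simp add: scalar_prod_def atLeast0LessThan)
  moreover have "mat_adjoint A $$ (m, b) = cnj (A $$ (b, m))" if "m < n" for m
    using A ab that by (simp add: mat_adjoint_def mat_of_rows_def)
  ultimately show ?thesis by simp
qed

section \<open>The real and imaginary parts of the matrices \<open>M_U\<close>\<close>

abbreviation M_parts :: "complex mat \<Rightarrow> nat \<Rightarrow> nat \<Rightarrow> real mat set" where
  "M_parts U i j \<equiv> {A_mat U i j, S_mat U i j}"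

lemma M_parts_carrier: "X \<in> M_parts U i j \<Longrightarrow> X \<in> carrier_mat (dim_row U) (dim_row U)"
  by (auto simp: A_mat_def S_mat_def M_mat_def)

text \<open>
  The imaginary part of \<open>m\<close> is the real part of \<open>- \<i> * m\<close>, so real and imaginary parts can be
  treated alike. In row \<open>j\<close> the entries are conjugated to bring the factor of \<open>U\<close> with
  row index \<open>a\<close> to the unconjugated place; this turns the constant \<open>z\<close> into \<open>- cnj z\<close>.
\<close>

lemma M_parts_row:
  assumes "X \<in> M_parts U i j" "a < dim_row U"
  obtains b \<zeta> where "\<zeta> = 0 \<or> a = i \<and> b = j \<or> a = j \<and> b = i"
    and "\<And>c. c < dim_row U \<Longrightarrow> X $$ (a, c) = Re (\<zeta> * (U $$ (a, c) * cnj (U $$ (b, c))))"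
proof -
  obtain z where z: "X = map_mat (\<lambda>m. Re (z * m)) (M_mat U i j)"
  proof -
    have "X = map_mat (\<lambda>m. Re (1 * m)) (M_mat U i j) \<or> X = map_mat (\<lambda>m. Re (- \<i> * m)) (M_mat U i j)"
      using assms(1) unfolding A_mat_def S_mat_def by auto
    then show ?thesis using that by blast
  qed
  have X: "X $$ (a, c) = Re (z * (if a = i then U $$ (i, c) * cnj (U $$ (j, c))
     else if a = j then - (U $$ (i, c) * cnj (U $$ (j, c))) else 0))"
    if "c < dim_row U" for c
    using that assms(2) by (simp add: z M_mat_def)
  consider "a = i" | "a \<noteq> i" "a = j" | "a \<noteq> i" "a \<noteq> j" by blast
  then show ?thesis
  proof cases
    case 1
    then show ?thesis using X by (intro that[of z j]) auto
  next
    case 2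
    then show ?thesis using X by (intro that[of "- cnj z" i]) (auto simp: algebra_simps)
  next
    case 3
    then show ?thesis using X by (intro that[of 0 i]) auto
  qed
qed

lemma M_parts_vanish:
  assumes "X \<in> M_parts U i j" "a < dim_row U" "c < dim_row U" "U $$ (a, c) = 0"
  shows "X $$ (a, c) = 0"
  using M_parts_row[OF assms(1,2)] assms(3,4) by (metis mult_zero_left mult_zero_right zero_complex.sel(1))

text \<open>This makes a product of real parts complex linear in products of the original numbers.\<close>

lemma Re_mult_Re: "Re p * Re p' = Re (p * p' + p * cnj p') / 2"
  by simp

text \<open>
  Because of \<open>inverse 0 = 0\<close> the weight is 0 exactly where \<open>U\<close> vanishes.
\<close>

abbreviation inv_sq :: "complex mat \<Rightarrow> nat \<Rightarrow> nat \<Rightarrow> real" where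
  "inv_sq U a c \<equiv> inverse ((cmod (U $$ (a, c)))\<^sup>2)"

locale unitary_kron =
  fixes ns :: "nat list" and Us :: "complex mat list" and U :: "complex mat"
  assumes len: "length Us = length ns"
    and pos: "\<And>k. k < length ns \<Longrightarrow> ns ! k > 0"
    and carr: "\<And>k. k < length ns \<Longrightarrow> Us ! k \<in> carrier_mat (ns ! k) (ns ! k)"
    and unit: "\<And>k. k < length ns \<Longrightarrow> unitary_mat (Us ! k)"
    and U: "U = kron_list Us"
begin

abbreviation "N \<equiv> prod_list ns"
abbreviation "r \<equiv> length ns"
abbreviation "ix \<equiv> vec_index ns"

lemma U_carrier: "U \<in> carrier_mat N N"
  unfolding U using kron_list_carrier[OF len] carr by blast

lemma dim_U: "dim_row U = N"
  using U_carrier by simp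

lemma U_index:
  "i < N \<Longrightarrow> j < N \<Longrightarrow> U $$ (i, j) = (\<Prod>k<r. (Us ! k) $$ (ix i k, ix j k))"
  unfolding U using kron_list_index[OF len] carr by blast

lemma ix_less: "k < r \<Longrightarrow> ix i k < ns ! k"
  using pos by (simp add: vec_index_def)

lemma ix_inj:
  assumes "i < N" "j < N" "\<And>k. k < r \<Longrightarrow> ix i k = ix j k"
  shows "i = j"
proof -
  have "lex_index ns (ix i) = lex_index ns (ix j)"
    unfolding lex_index_def using assms(3) by (intro sum.cong) auto
  then show ?thesis using assms by (simp add: lex_index_vec_index)
qed

lemma row_orthogonal:
  "k < r \<Longrightarrow> a < ns ! k \<Longrightarrow> b < ns ! k \<Longrightarrow> a \<noteq> b \<Longrightarrow>
    (\<Sum>m<ns ! k. (Us ! k) $$ (a, m) * cnj ((Us ! k) $$ (b, m))) = 0"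
  by (rule unitary_rows_orthogonal) (use carr unit in auto)

text \<open>
  Both sums are products over the tensor positions, and the factor at \<open>k\<close> is 0: as rows \<open>a\<close> and
  \<open>b\<close> select the same row of the factor \<open>Us ! k\<close>, the weight cancels against that row's squared
  modulus and leaves the inner product of two different rows, or its conjugate.
\<close>

lemma weighted_products_vanish:
  assumes abb: "a < N" "b < N" "b' < N" and k: "k < r" "ix a k = ix b k" "ix a k \<noteq> ix b' k"
  shows "(\<Sum>c<N. inv_sq U a c * ((U $$ (a, c) * cnj (U $$ (b, c))) * (U $$ (a, c) * cnj (U $$ (b', c))))) = 0"
    and "(\<Sum>c<N. inv_sq U a c * ((U $$ (a, c) * cnj (U $$ (b, c))) * cnj (U $$ (a, c) * cnj (U $$ (b', c))))) = 0"
proof -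
  define w where "w u = complex_of_real (inverse ((cmod u)\<^sup>2))" for u :: complex
  have inv_w: "complex_of_real (inverse ((cmod u)\<^sup>2)) = w u" for u
    unfolding w_def ..
  have w_prod: "w (\<Prod>l<r. f l) = (\<Prod>l<r. w (f l))" for f :: "nat \<Rightarrow> complex"
    unfolding w_def by (simp add: prod_norm[symmetric] prod_power_distrib prod_inversef[unfolded comp_def, symmetric])
  have w_mult: "w u * (u * cnj u) = (if u = 0 then 0 else 1)" for u
    unfolding w_def by (simp add: complex_norm_square[symmetric] flip: of_real_mult of_real_power)
  let ?u = "\<lambda>l m. (Us ! l) $$ (ix a l, m)"
  let ?v = "\<lambda>l m. (Us ! l) $$ (ix b l, m)"
  let ?v' = "\<lambda>l m. (Us ! l) $$ (ix b' l, m)"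
  let ?f = "\<lambda>l m. w (?u l m) * ((?u l m * cnj (?v l m)) * (?u l m * cnj (?v' l m)))"
  let ?g = "\<lambda>l m. w (?u l m) * ((?u l m * cnj (?v l m)) * cnj (?u l m * cnj (?v' l m)))"
  have 0: "(\<Sum>m<ns ! k. ?u k m * cnj (?v' k m)) = 0"
    using row_orthogonal[OF k(1)] k ix_less by blast
  \<comment> \<open>Where \<open>?u k m = 0\<close>, the weight cancels nothing, but then the right side is 0 as well.\<close>
  have f: "?f k m = ?u k m * cnj (?v' k m)" for m
  proof -
    have "?f k m = w (?u k m) * (?u k m * cnj (?u k m)) * (?u k m * cnj (?v' k m))"
      using k(2) by (simp only: ac_simps complex_cnj_mult complex_cnj_cnj)
    also have "\<dots> = ?u k m * cnj (?v' k m)"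
      unfolding w_mult by simp
    finally show ?thesis .
  qed
  have g: "?g k m = cnj (?u k m * cnj (?v' k m))" for m
  proof -
    have "?g k m = w (?u k m) * (?u k m * cnj (?u k m)) * cnj (?u k m * cnj (?v' k m))"
      using k(2) by (simp only: ac_simps complex_cnj_mult complex_cnj_cnj)
    also have "\<dots> = cnj (?u k m * cnj (?v' k m))"
      unfolding w_mult by simp
    finally show ?thesis .
  qed
  have "(\<Sum>c<N. inv_sq U a c * ((U $$ (a, c) * cnj (U $$ (b, c))) * (U $$ (a, c) * cnj (U $$ (b', c))))) =
      (\<Sum>c<N. \<Prod>l<r. ?f l (ix c l))"
    by (intro sum.cong refl)
      (simp only: inv_w U_index abb lessThan_iff w_prod prod.distrib cnj_prod complex_cnj_mult)
  also have "\<dots> = (\<Prod>l<r. \<Sum>m<ns ! l. ?f l m)"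
    by (rule sum_prod_vec_index)
  also have "\<dots> = 0"
  proof -
    have "(\<Sum>m<ns ! k. ?f k m) = 0"
      unfolding f by (rule 0)
    then show ?thesis
      using k(1) unfolding prod_zero_iff[OF finite_lessThan] by blast
  qed
  finally show "(\<Sum>c<N. inv_sq U a c * ((U $$ (a, c) * cnj (U $$ (b, c))) * (U $$ (a, c) * cnj (U $$ (b', c))))) = 0" .
  have "(\<Sum>c<N. inv_sq U a c * ((U $$ (a, c) * cnj (U $$ (b, c))) * cnj (U $$ (a, c) * cnj (U $$ (b', c))))) =
      (\<Sum>c<N. \<Prod>l<r. ?g l (ix c l))"
    by (intro sum.cong refl)
      (simp only: inv_w U_index abb lessThan_iff w_prod prod.distrib cnj_prod complex_cnj_mult)
  also have "\<dots> = (\<Prod>l<r. \<Sum>m<ns ! l. ?g l m)"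
    by (rule sum_prod_vec_index)
  also have "\<dots> = 0"
  proof -
    have "(\<Sum>m<ns ! k. ?g k m) = cnj (\<Sum>m<ns ! k. ?u k m * cnj (?v' k m))"
      unfolding g cnj_sum ..
    then have "(\<Sum>m<ns ! k. ?g k m) = 0"
      unfolding 0 by simp
    then show ?thesis
      using k(1) unfolding prod_zero_iff[OF finite_lessThan] by blast
  qed
  finally show "(\<Sum>c<N. inv_sq U a c * ((U $$ (a, c) * cnj (U $$ (b, c))) * cnj (U $$ (a, c) * cnj (U $$ (b', c))))) = 0" .
qed

text \<open>
  The two sums in the preceding lemma are exactly those that arise when the product of the real
  parts is expanded by \<open>Re_mult_Re\<close>.
\<close>

lemma weighted_rows_orthogonal:
  assumes abb: "a < N" "b < N" "b' < N" and k: "k < r" "ix a k = ix b k" "ix a k \<noteq> ix b' k"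
  shows "(\<Sum>c<N. inv_sq U a c * Re (\<zeta> * (U $$ (a, c) * cnj (U $$ (b, c))))
    * Re (\<zeta>' * (U $$ (a, c) * cnj (U $$ (b', c))))) = 0"
proof -
  let ?p = "\<lambda>c. U $$ (a, c) * cnj (U $$ (b, c))" and ?p' = "\<lambda>c. U $$ (a, c) * cnj (U $$ (b', c))"
  have "(\<Sum>c<N. inv_sq U a c * Re (\<zeta> * ?p c) * Re (\<zeta>' * ?p' c)) =
      (\<Sum>c<N. Re (\<zeta> * \<zeta>' / 2 * (inv_sq U a c * (?p c * ?p' c))
        + \<zeta> * cnj \<zeta>' / 2 * (inv_sq U a c * (?p c * cnj (?p' c)))))"
  proof (rule sum.cong[OF refl])
    fix c
    have "inv_sq U a c * Re (\<zeta> * ?p c) * Re (\<zeta>' * ?p' c) =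
        inv_sq U a c * (Re ((\<zeta> * ?p c) * (\<zeta>' * ?p' c) + (\<zeta> * ?p c) * cnj (\<zeta>' * ?p' c)) / 2)"
      unfolding Re_mult_Re[symmetric] by (rule mult.assoc)
    also have "\<dots> = Re (complex_of_real (inv_sq U a c / 2) *
        ((\<zeta> * ?p c) * (\<zeta>' * ?p' c) + (\<zeta> * ?p c) * cnj (\<zeta>' * ?p' c)))"
      by (simp only: Re_complex_of_real Im_complex_of_real times_complex.sel)
    also have "complex_of_real (inv_sq U a c / 2) *
        ((\<zeta> * ?p c) * (\<zeta>' * ?p' c) + (\<zeta> * ?p c) * cnj (\<zeta>' * ?p' c)) =
        \<zeta> * \<zeta>' / 2 * (inv_sq U a c * (?p c * ?p' c))
        + \<zeta> * cnj \<zeta>' / 2 * (inv_sq U a c * (?p c * cnj (?p' c)))"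
      by (simp add: algebra_simps)
    finally show "inv_sq U a c * Re (\<zeta> * ?p c) * Re (\<zeta>' * ?p' c) =
      Re (\<zeta> * \<zeta>' / 2 * (inv_sq U a c * (?p c * ?p' c))
        + \<zeta> * cnj \<zeta>' / 2 * (inv_sq U a c * (?p c * cnj (?p' c))))" .
  qed
  also have "\<dots> = Re (\<zeta> * \<zeta>' / 2 * (\<Sum>c<N. inv_sq U a c * (?p c * ?p' c))
        + \<zeta> * cnj \<zeta>' / 2 * (\<Sum>c<N. inv_sq U a c * (?p c * cnj (?p' c))))"
    unfolding Re_sum[symmetric] sum.distrib sum_distrib_left ..
  also have "\<dots> = 0"
    unfolding weighted_products_vanish[OF assms] by simp
  finally show ?thesis .
qed

text \<open>
  The form is 0 row by row. A row in which both matrices are nonzero belongs to both pairs of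
  indices, so the second kind of separation leaves no such row. In the first kind, exactly one of
  the partners of the row agrees with it at position \<open>k\<close>.
\<close>

lemma M_parts_orthogonal:
  assumes ij: "i < N" "j < N" "i' < N" "j' < N" and k: "k < r"
    and XY: "X \<in> M_parts U i j" "Y \<in> M_parts U i' j'"
    and sep: "(ix i k = ix j k) \<noteq> (ix i' k = ix j' k) \<or>
      ix i k = ix j k \<and> ix i' k = ix j' k \<and> ix i k \<noteq> ix i' k"
  shows "weighted_form N (inv_sq U) X Y = 0"
  unfolding weighted_form_def
proof (rule sum.neutral, rule ballI)
  fix a assume "a \<in> {..<N}"
  then have a: "a < N" by simp
  obtain b \<zeta> where b: "\<zeta> = 0 \<or> a = i \<and> b = j \<or> a = j \<and> b = i"
    and X: "\<And>c. c < N \<Longrightarrow> X $$ (a, c) = Re (\<zeta> * (U $$ (a, c) * cnj (U $$ (b, c))))"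
    by (rule M_parts_row[OF XY(1), unfolded dim_U, OF a]) (rule that)
  obtain b' \<zeta>' where b': "\<zeta>' = 0 \<or> a = i' \<and> b' = j' \<or> a = j' \<and> b' = i'"
    and Y: "\<And>c. c < N \<Longrightarrow> Y $$ (a, c) = Re (\<zeta>' * (U $$ (a, c) * cnj (U $$ (b', c))))"
    by (rule M_parts_row[OF XY(2), unfolded dim_U, OF a]) (rule that)
  have "(\<Sum>c<N. inv_sq U a c * X $$ (a, c) * Y $$ (a, c)) =
      (\<Sum>c<N. inv_sq U a c * Re (\<zeta> * (U $$ (a, c) * cnj (U $$ (b, c))))
        * Re (\<zeta>' * (U $$ (a, c) * cnj (U $$ (b', c)))))"
    by (intro sum.cong refl) (simp add: X Y)
  also have "\<dots> = 0"
  proof (cases "\<zeta> = 0 \<or> \<zeta>' = 0")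
    case True
    then show ?thesis by auto
  next
    case False
    then have bN: "b < N" "b' < N" using b b' ij by auto
    have "(ix a k = ix b k) \<noteq> (ix a k = ix b' k)"
      using False b b' sep by metis
    then consider "ix a k = ix b k" "ix a k \<noteq> ix b' k" | "ix a k = ix b' k" "ix a k \<noteq> ix b k"
      by blast
    then show ?thesis
    proof cases
      case 1
      then show ?thesis by (rule weighted_rows_orthogonal[OF a bN k])
    next
      case 2
      show ?thesis
        using weighted_rows_orthogonal[OF a bN(2,1) k 2, of \<zeta>' \<zeta>] by (simp only: ac_simps)
    qed
  qed
  finally show "(\<Sum>c<N. inv_sq U a c * X $$ (a, c) * Y $$ (a, c)) = 0" .
qed

section \<open>Agreement patterns\<close>

definition agreement :: "nat list \<times> nat list \<Rightarrow> nat \<Rightarrow> nat \<Rightarrow> bool" where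
  "agreement = (\<lambda>(ks, vs) i j.
     (\<forall>s<length ks. ix i (ks ! s) = vs ! s \<and> ix j (ks ! s) = vs ! s) \<and>
     (\<forall>k\<in>{..<r} - set ks. ix i k \<noteq> ix j k))"

definition summand_gens :: "nat list \<times> nat list \<Rightarrow> real mat set" where
  "summand_gens T = \<Union>{M_parts U i j | i j. i < j \<and> j < N \<and> agreement T i j}"

lemma summand_gensE:
  assumes "X \<in> summand_gens T"
  obtains i j where "i < N" "j < N" "agreement T i j" "X \<in> M_parts U i j"
  using assms unfolding summand_gens_def by (auto intro: less_trans)

lemma summand_gens_carrier: "summand_gens T \<subseteq> carrier_mat N N"
proof
  fix X assume "X \<in> summand_gens T"
  then obtain i j where "X \<in> M_parts U i j" by (rule summand_gensE)
  then show "X \<in> carrier_mat N N" by (rule M_parts_carrier[of X U i j, unfolded dim_U])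
qed

lemma MM_sub_eq_span: "(\<lambda>(ks, vs). MM_sub ns U ks vs) = (\<lambda>T. real_span N (summand_gens T))"
  unfolding MM_sub_def summand_gens_def agreement_def dim_U by (auto simp: fun_eq_iff)

lemma agreement_set:
  assumes "agreement (ks, vs) i j" "k < r"
  shows "ix i k = ix j k \<longleftrightarrow> k \<in> set ks"
proof
  assume "ix i k = ix j k"
  then show "k \<in> set ks" using assms unfolding agreement_def prod.case by blast
next
  assume "k \<in> set ks"
  then obtain s where "s < length ks" "k = ks ! s" by (metis in_set_conv_nth)
  then show "ix i k = ix j k" using assms unfolding agreement_def by simp
qed

lemma summand_indicesD:
  assumes "(ks, vs) \<in> summand_indices ns"
  shows "length ks = length vs" "sorted_wrt (<) ks" "set ks \<subseteq> {..<r}"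
  using assms unfolding summand_indices_def by auto

text \<open>
  A summand index is determined by its set of positions, as \<open>ks\<close> is sorted, together with the
  values there. So different summands differ in whether a position is one of agreement, or in
  the value at a common one.
\<close>

lemma agreement_separates:
  assumes T: "T \<in> summand_indices ns" "T' \<in> summand_indices ns" "T \<noteq> T'"
    and agr: "agreement T i j" "agreement T' i' j'"
  obtains k where "k < r"
    "(ix i k = ix j k) \<noteq> (ix i' k = ix j' k) \<or>
      ix i k = ix j k \<and> ix i' k = ix j' k \<and> ix i k \<noteq> ix i' k"
proof -
  obtain ks vs ks' vs' where eq: "T = (ks, vs)" "T' = (ks', vs')" by fastforce
  note D = summand_indicesD[OF T(1)[unfolded eq]] summand_indicesD[OF T(2)[unfolded eq]]
  note S = agreement_set[OF agr(1)[unfolded eq]] agreement_set[OF agr(2)[unfolded eq]]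
  show ?thesis
  proof (cases "set ks = set ks'")
    case False
    then obtain k where "(k \<in> set ks) \<noteq> (k \<in> set ks')" by blast
    then show ?thesis using that[of k] S D(3,6) by blast
  next
    case True
    then have ks: "ks = ks'"
      using D(2,5) by (simp add: strict_sorted_equal)
    then have "vs \<noteq> vs'" using T(3) eq by simp
    then obtain s where s: "s < length ks" "vs ! s \<noteq> vs' ! s"
      using D(1,4) ks by (metis nth_equalityI)
    have "ks ! s < r" using D(3) s(1) nth_mem by blast
    moreover have "ix i (ks ! s) = vs ! s" "ix j (ks ! s) = vs ! s"
      "ix i' (ks ! s) = vs' ! s" "ix j' (ks ! s) = vs' ! s"
      using agr s(1) unfolding eq agreement_def ks by auto
    ultimately show ?thesis using that[of "ks ! s"] s(2) by simp
  qed
qed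

text \<open>
  The positions of agreement do not exhaust \<open>{..<r}\<close>, as the indices differ. This is what the bound
  \<open>p \<le> r - 1\<close> on the number of positions in a summand index asks for.
\<close>

lemma agreement_exists:
  assumes "i < N" "j < N" "i \<noteq> j"
  obtains T where "T \<in> summand_indices ns" "agreement T i j"
proof -
  define K where "K = {k \<in> {..<r}. ix i k = ix j k}"
  define ks where "ks = sorted_list_of_set K"
  define vs where "vs = map (ix i) ks"
  have K: "finite K" "K \<subseteq> {..<r}" unfolding K_def by auto
  have ks: "set ks = K" "length ks = card K" "sorted_wrt (<) ks"
    unfolding ks_def using K(1) by simp_all
  have "K \<noteq> {..<r}"
    using ix_inj[OF assms(1,2)] assms(3) unfolding K_def by blast
  then have "card K < r"
    using K by (metis card_lessThan finite_lessThan psubsetI psubset_card_mono)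
  then have "(ks, vs) \<in> summand_indices ns"
  proof (cases "card K = 0")
    case True
    then show ?thesis using ks(2) by (simp add: summand_indices_def vs_def)
  next
    case False
    moreover have "vs ! s < ns ! (ks ! s)" if "s < card K" for s
      using that ks K(2) nth_mem[of s ks] ix_less by (auto simp: vs_def)
    ultimately show ?thesis
      using \<open>card K < r\<close> ks K(2) unfolding summand_indices_def vs_def by auto
  qed
  moreover have "agreement (ks, vs) i j"
  proof -
    have "ix j (ks ! s) = ix i (ks ! s)" if "s < length ks" for s
      using nth_mem[OF that] unfolding ks(1) K_def by simp
    then show ?thesis
      unfolding agreement_def prod.case ks(1) by (auto simp: vs_def K_def)
  qed
  ultimately show ?thesis using that by blast
qed

lemma MM_eq_span: "MM U = real_span N (\<Union>T\<in>summand_indices ns. summand_gens T)"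
proof -
  have "\<Union>{M_parts U i j | i j. i < j \<and> j < N} = (\<Union>T\<in>summand_indices ns. summand_gens T)"
  proof (intro equalityI subsetI)
    fix X assume "X \<in> \<Union>{M_parts U i j | i j. i < j \<and> j < N}"
    then obtain i j where ij: "i < j" "j < N" "X \<in> M_parts U i j" by blast
    moreover from ij obtain T where "T \<in> summand_indices ns" "agreement T i j"
      using agreement_exists[of i j] by auto
    ultimately show "X \<in> (\<Union>T\<in>summand_indices ns. summand_gens T)"
      unfolding summand_gens_def by blast
  qed (unfold summand_gens_def, blast)
  then show ?thesis
    unfolding MM_def dim_U by simp
qed

lemma MM_algebraic_sum:
  "MM U = algebraic_sum (real_mat_space N) (summand_indices ns) (\<lambda>T. real_span N (summand_gens T))"
  unfolding MM_eq_span by (rule real_span_UN[OF finite_summand_indices summand_gens_carrier])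

lemma MM_direct_sum:
  "direct_sum_family (real_mat_space N) (summand_indices ns) (\<lambda>T. real_span N (summand_gens T))"
proof (rule direct_sum_family_orthogonal[OF finite_summand_indices summand_gens_carrier, where q = "inv_sq U"])
  fix T X a c
  assume X: "X \<in> summand_gens T" and ac: "a < N" "c < N" "inv_sq U a c = 0"
  obtain i j where "X \<in> M_parts U i j"
    using X by (rule summand_gensE)
  then show "X $$ (a, c) = 0"
    using M_parts_vanish[of X U i j a c] ac unfolding dim_U by simp
next
  fix T T' X Y
  assume T: "T \<in> summand_indices ns" "T' \<in> summand_indices ns" "T \<noteq> T'"
    and XY: "X \<in> summand_gens T" "Y \<in> summand_gens T'"
  obtain i j where ij: "i < N" "j < N" "agreement T i j" "X \<in> M_parts U i j"
    using XY(1) by (rule summand_gensE)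
  obtain i' j' where ij': "i' < N" "j' < N" "agreement T' i' j'" "Y \<in> M_parts U i' j'"
    using XY(2) by (rule summand_gensE)
  obtain k where "k < r" and k: "(ix i k = ix j k) \<noteq> (ix i' k = ix j' k) \<or>
      ix i k = ix j k \<and> ix i' k = ix j' k \<and> ix i k \<noteq> ix i' k"
    using agreement_separates[OF T ij(3) ij'(3)] .
  then show "weighted_form N (inv_sq U) X Y = 0"
    by (intro M_parts_orthogonal[OF ij(1,2) ij'(1,2) _ ij(4) ij'(4)])
qed simp

end

section \<open>The direct sum decomposition\<close>

theorem theorem2p6:
  fixes r :: nat and ns :: "nat list" and Us :: "complex mat list" and U :: "complex mat"
  assumes "r \<ge> 1" and "length ns = r" and "length Us = r"
    and "\<forall>k<r. ns ! k \<ge> 2"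
    and "\<forall>k<r. Us ! k \<in> carrier_mat (ns ! k) (ns ! k) \<and> unitary_mat (Us ! k)"
    and "U = kron_list Us"
  shows "MM U = algebraic_sum (real_mat_space (prod_list ns)) (summand_indices ns)
             (\<lambda>(ks, vs). MM_sub ns U ks vs)
       \<and> direct_sum_family (real_mat_space (prod_list ns)) (summand_indices ns)
             (\<lambda>(ks, vs). MM_sub ns U ks vs)"
proof -
  interpret unitary_kron ns Us U
  proof
    show "ns ! k > 0" if "k < length ns" for k
      using assms that by (metis less_le_trans zero_less_numeral)
  qed (use assms in auto)
  show ?thesis
    unfolding MM_sub_eq_span using MM_algebraic_sum MM_direct_sum by blast
qed

end
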